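(* For every positive rational number $r$, the complete tripartite graph $K_{1,3,3}$ is (isomorphic to) a subgraph of $G(\mathbb{Q}^5,\sqrt{r})$.
   Context: For $S \subseteq \mathbb{R}$, a positive integer $n$ and $d>0$, $G(S^n,d)$ denotes the graph with vertex set $S^n$ in which two vertices are adjacent if and only if their Euclidean distance is exactly $d$. Subgraphs need not be induced. *)

theory Defs
  imports "HOL-Analysis.Analysis" "Graph_Theory.Graph_Theory"
begin

text \<open>
  As in \<^theory>\<open>Graph_Theory.Digraph\<close>, an undirected graph is represented by a symmetric
  digraph, an edge between \<open>u\<close> and \<open>v\<close> being the two arcs \<open>(u, v)\<close> and \<open>(v, u)\<close>.
\<close>

text \<open>
  The graph $G(S^n, d)$. The dimension $n$ is the cardinality of the index type \<open>'n\<close>; the metric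
  on \<^typ>\<open>real ^ 'n\<close> is the Euclidean one.
\<close>

definition distance_graph :: "real set \<Rightarrow> real \<Rightarrow> (real ^ 'n) pair_pre_digraph" where
  "distance_graph S d =
    (let V = {x. \<forall>i. x $ i \<in> S}
     in \<lparr> pverts = V, parcs = {(x, y). x \<in> V \<and> y \<in> V \<and> dist x y = d} \<rparr>)"

lemma pair_bidirected_digraph_distance_graph:
  "d > 0 \<Longrightarrow> pair_bidirected_digraph (distance_graph S d)"
  by unfold_locales
    (auto simp: distance_graph_def Let_def dist_commute symmetric_def intro!: symI)

text \<open>
  The complete multipartite graph whose parts have the sizes listed in \<open>ks\<close>;
  \<open>(i, j)\<close> is the \<open>j\<close>-th vertex of the \<open>i\<close>-th part.
\<close>

definition complete_multipartite :: "nat list \<Rightarrow> (nat \<times> nat) pair_pre_digraph" where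
  "complete_multipartite ks =
    (let V = {(i, j). i < length ks \<and> j < ks ! i}
     in \<lparr> pverts = V, parcs = {(u, v). u \<in> V \<and> v \<in> V \<and> fst u \<noteq> fst v} \<rparr>)"

lemma pair_graph_complete_multipartite: "pair_graph (complete_multipartite ks)"
proof -
  let ?V = "{(i, j). i < length ks \<and> j < ks ! i}"
  have "?V = (SIGMA i:{..<length ks}. {..<ks ! i})"
    by auto
  then have fin: "finite ?V"
    by simp
  have "finite {(u, v). u \<in> ?V \<and> v \<in> ?V \<and> fst u \<noteq> fst v}"
    by (rule finite_subset[OF _ finite_cartesian_product[OF fin fin]]) auto
  with fin show ?thesis
    by unfold_locales
      (auto simp: complete_multipartite_def Let_def symmetric_def intro!: symI)
qed

definition isomorphic_to_subgraph :: "('a, 'b) pre_digraph \<Rightarrow> ('c, 'd) pre_digraph \<Rightarrow> bool" where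
  "isomorphic_to_subgraph K G \<longleftrightarrow> (\<exists>H. subgraph H G \<and> digraph_iso K H)"

end

theory Submission
  imports Defs "HOL-Computational_Algebra.Primes"
begin

text \<open>
  Put \<open>m = r / 2\<close> and write \<open>m = a\<^sup>2 + b\<^sup>2 + c\<^sup>2 + d\<^sup>2\<close> with rational \<open>a, b, c, d\<close>. Multiplying the
  quaternion units by \<open>a + bi + cj + dk\<close> gives four pairwise orthogonal rational vectors
  \<open>v\<^sub>1, \<dots>, v\<^sub>4\<close> of squared length \<open>m\<close>, all orthogonal to the fifth basis vector \<open>e\<close>. Whenever
  \<open>u \<in> \<langle>v\<^sub>2, v\<^sub>3\<rangle>\<close> and \<open>w \<in> \<langle>v\<^sub>4, e\<rangle>\<close> have squared length \<open>m\<close>, the points \<open>0\<close>, \<open>v\<^sub>1 + u\<close> and \<open>v\<^sub>1 + w\<close>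
  have pairwise squared distance \<open>2m = r\<close>. So it suffices to find three such \<open>u\<close> and three such \<open>w\<close>;
  a third rational point on the conic \<open>m x\<^sup>2 + y\<^sup>2 = m\<close>, besides \<open>(\<plusminus>1, 0)\<close>, lies on the line of slope 1
  through \<open>(-1, 0)\<close>.
\<close>

section \<open>Sums of four rational squares\<close>

definition sum_of_four_squares :: "'a::comm_semiring_1 \<Rightarrow> bool" where
  "sum_of_four_squares x \<longleftrightarrow> (\<exists>a b c d. x = a\<^sup>2 + b\<^sup>2 + c\<^sup>2 + d\<^sup>2)"

text \<open>Euler's identity, that is, multiplicativity of the quaternion norm: the four squares are
  the coordinates of \<open>(e + fi + gj + hk)\<close> times the conjugate of
  \<open>a + bi + cj + dk\<close>.\<close>

lemma sum_of_four_squares_mult: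
  fixes x y :: "'a::comm_ring_1"
  assumes "sum_of_four_squares x" "sum_of_four_squares y"
  shows "sum_of_four_squares (x * y)"
proof -
  obtain a b c d where x: "x = a\<^sup>2 + b\<^sup>2 + c\<^sup>2 + d\<^sup>2"
    using assms(1) unfolding sum_of_four_squares_def by blast
  obtain e f g h where y: "y = e\<^sup>2 + f\<^sup>2 + g\<^sup>2 + h\<^sup>2"
    using assms(2) unfolding sum_of_four_squares_def by blast
  have "x * y = (a*e + b*f + c*g + d*h)\<^sup>2 + (a*f - b*e + c*h - d*g)\<^sup>2
      + (a*g - b*h - c*e + d*f)\<^sup>2 + (a*h + b*g - c*f - d*e)\<^sup>2"
    unfolding x y by (simp add: power2_eq_square algebra_simps)
  then show ?thesis
    unfolding sum_of_four_squares_def by blast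
qed

text \<open>Dividing by \<open>y\<close> is multiplying by \<open>y\<close> and by the square of
  \<open>1 / y\<close>.\<close>

lemma sum_of_four_squares_divide:
  fixes x y :: "'a::field"
  assumes "sum_of_four_squares x" "sum_of_four_squares y"
  shows "sum_of_four_squares (x / y)"
proof -
  have "sum_of_four_squares ((1 / y)\<^sup>2)"
    unfolding sum_of_four_squares_def by (rule exI[of _ "1 / y"], (rule exI[of _ 0])+) simp
  then have "sum_of_four_squares (x * y * (1 / y)\<^sup>2)"
    using assms by (intro sum_of_four_squares_mult)
  then show ?thesis
    by (cases "y = 0") (simp_all add: power2_eq_square field_simps)
qed

text \<open>A prime dividing \<open>(x - y) * (x + y)\<close> divides a factor. Both factors are
  below \<open>p\<close> in absolute value, so that factor is 0; \<open>x + y = 0\<close> forces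
  \<open>x = y = 0\<close>.\<close>

lemma inj_on_square_mod_prime:
  fixes p h :: int
  assumes "prime p" "p = 2 * h + 1"
  shows "inj_on (\<lambda>x. x\<^sup>2 mod p) {0..h}"
proof (rule inj_onI)
  fix x y
  assume xy: "x \<in> {0..h}" "y \<in> {0..h}" and "x\<^sup>2 mod p = y\<^sup>2 mod p"
  then have "p dvd x\<^sup>2 - y\<^sup>2"
    by (simp add: mod_eq_dvd_iff)
  then have "p dvd (x - y) * (x + y)"
    by (simp add: power2_eq_square algebra_simps)
  then have "p dvd x - y \<or> p dvd x + y"
    using \<open>prime p\<close> by (simp add: prime_dvd_mult_iff)
  then show "x = y"
  proof
    assume "p dvd x - y"
    then show ?thesis
      using xy assms(2) dvd_imp_le_int[of "x - y" p] by force
  next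
    assume "p dvd x + y"
    then show ?thesis
      using xy assms(2) zdvd_not_zless[of "x + y" p] by force
  qed
qed

text \<open>Pigeonhole for odd \<open>p = 2 * h + 1\<close>: the squares of \<open>0, ..., h\<close>
  and the residues of \<open>-1 - y^2\<close> for the same range fill \<open>h + 1\<close> classes
  each, together one more than \<open>p\<close>, so they meet. The bound \<open>k < p\<close> makes
  an induction on \<open>p\<close> possible.\<close>

lemma prime_multiple_two_squares_plus_one:
  fixes p :: nat
  assumes "prime p"
  obtains k :: nat and x y :: int where "0 < k" "k < p" "int (k * p) = x\<^sup>2 + y\<^sup>2 + 1"
proof (cases "p = 2")
  case True
  show ?thesis
    by (rule that[of 1 1 0]) (simp_all add: True)
next
  case False
  define P where "P = int p"
  define h where "h = P div 2"
  have "odd p"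
    using assms False prime_odd_nat prime_ge_2_nat[OF assms] by force
  then have Ph: "P = 2 * h + 1"
    unfolding h_def P_def by presburger
  have "prime P"
    using assms by (simp add: P_def)
  moreover have "P > 0" "h \<ge> 1"
    using False prime_ge_2_nat[OF assms] Ph by (auto simp: P_def)
  ultimately have P: "prime P" "P > 0" "h \<ge> 1"
    by blast+
  let ?A = "(\<lambda>x. x\<^sup>2 mod P) ` {0..h}"
  let ?B = "(\<lambda>x. (- 1 - x) mod P) ` ?A"
  have inj: "inj_on (\<lambda>x. (- 1 - x) mod P) ?A"
  proof (rule inj_onI)
    fix s t
    assume st: "s \<in> ?A" "t \<in> ?A" and "(- 1 - s) mod P = (- 1 - t) mod P"
    then have "P dvd (- 1 - s) - (- 1 - t)"
      by (simp only: mod_eq_dvd_iff)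
    then have "t mod P = s mod P"
      by (simp add: mod_eq_dvd_iff)
    then show "s = t"
      using st by auto
  qed
  have "card ?A = nat (h + 1)"
    by (simp add: card_image inj_on_square_mod_prime[OF P(1) Ph])
  moreover have "card ?B = card ?A"
    by (rule card_image[OF inj])
  moreover have "card (?A \<union> ?B) \<le> card {0..<P}"
    using P(2) by (intro card_mono) auto
  ultimately have "?A \<inter> ?B \<noteq> {}"
    using card_Un_disjoint[of ?A ?B] Ph P by auto
  then obtain x y where xy: "x \<in> {0..h}" "y \<in> {0..h}" "x\<^sup>2 mod P = (- 1 - y\<^sup>2 mod P) mod P"
    by blast
  then have "P dvd x\<^sup>2 - (- 1 - y\<^sup>2)"
    by (simp add: mod_simps mod_eq_dvd_iff)
  then obtain k where k: "x\<^sup>2 + y\<^sup>2 + 1 = P * k"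
    by (auto simp: dvd_def algebra_simps)
  \<comment> \<open>Taking both roots from \<open>0..h\<close> keeps the multiple small:
    \<open>2 * h^2 + 1 < (2 * h + 1)^2\<close>.\<close>
  have "x\<^sup>2 \<le> h\<^sup>2" "y\<^sup>2 \<le> h\<^sup>2"
    using xy by (auto intro: power_mono)
  then have "P * k \<le> 2 * h\<^sup>2 + 1"
    using k by linarith
  also have "\<dots> < P * P"
    using P(3) unfolding Ph by (simp add: power2_eq_square algebra_simps add_pos_nonneg)
  finally have "k < P"
    using P(2) by simp
  have "P * k > 0"
    unfolding k[symmetric] by (simp add: add_nonneg_pos)
  then have "k > 0"
    using P(2) by (simp add: zero_less_mult_iff)
  show ?thesis
    by (rule that[of "nat k" x y])
       (use \<open>k > 0\<close> \<open>k < P\<close> k in \<open>auto simp: P_def mult.commute\<close>)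
qed

text \<open>Composite numbers follow by multiplicativity. A prime \<open>n\<close> is the quotient
  of the sum of squares \<open>k * n\<close> by \<open>k < n\<close>, which the induction hypothesis
  covers; division in a field replaces Lagrange's descent over the integers.\<close>

lemma sum_of_four_squares_of_nat:
  "sum_of_four_squares (of_nat n :: 'a::field_char_0)"
proof (induction n rule: less_induct)
  case (less n)
  consider "n = 0" | "n = 1" | "prime n" | a b where "n = a * b" "a < n" "b < n"
  proof (cases "n \<le> 1 \<or> prime n")
    case False
    then obtain a where a: "a dvd n" "a \<noteq> 1" "a \<noteq> n"
      by (auto simp: prime_nat_iff)
    then obtain b where "n = a * b"
      by blast
    moreover from this have "b \<noteq> 0" "b \<noteq> 1" "a \<noteq> 0"
      using a False by auto
    ultimately show ?thesis
      using a that(4)[of a b] by auto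
  qed (use that in fastforce)
  then show ?case
  proof cases
    case 1
    then show ?thesis
      unfolding sum_of_four_squares_def by (intro exI[of _ 0]) simp
  next
    case 2
    then show ?thesis
      unfolding sum_of_four_squares_def by (intro exI[of _ 1] exI[of _ 0]) simp
  next
    case 3
    then obtain k x y where k: "0 < k" "k < n" "int (k * n) = x\<^sup>2 + y\<^sup>2 + 1"
      by (rule prime_multiple_two_squares_plus_one)
    have "of_nat (k * n) = (of_int (x\<^sup>2 + y\<^sup>2 + 1) :: 'a)"
      unfolding k(3)[symmetric] by simp
    also have "\<dots> = (of_int x)\<^sup>2 + (of_int y)\<^sup>2 + 1\<^sup>2 + 0\<^sup>2"
      by simp
    finally have "sum_of_four_squares (of_nat (k * n) :: 'a)"
      unfolding sum_of_four_squares_def by blast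
    then have "sum_of_four_squares (of_nat (k * n) / of_nat k :: 'a)"
      using less.IH k(2) by (intro sum_of_four_squares_divide)
    then show ?thesis
      using k(1) by simp
  next
    case 4
    then show ?thesis
      using less.IH sum_of_four_squares_mult by (metis of_nat_mult)
  qed
qed

lemma sum_of_four_squares_rat:
  fixes q :: rat
  assumes "q \<ge> 0"
  shows "sum_of_four_squares q"
proof -
  obtain a b where "q = of_int a / of_int b" "b > 0"
    using quotient_of_div[of q] quotient_of_denom_pos[of q] by (metis surj_pair)
  with assms have "q = of_nat (nat a) / of_nat (nat b)"
    by (simp add: zero_le_divide_iff)
  then show ?thesis
    by (metis sum_of_four_squares_of_nat sum_of_four_squares_divide)
qed

section \<open>Embedding complete multipartite graphs\<close>

text \<open>The subgraph is the image of \<open>K\<close> itself. Arcs are pairs of vertices, so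
  \<open>map_prod f f\<close> is injective on them because \<open>f\<close> is injective on
  vertices.\<close>

lemma isomorphic_to_subgraph_with_projI:
  assumes "pair_wf_digraph K" "pair_wf_digraph G"
    and "inj_on f (pverts K)" "f ` pverts K \<subseteq> pverts G"
    and arcs: "\<And>u v. (u, v) \<in> parcs K \<Longrightarrow> (f u, f v) \<in> parcs G"
  shows "isomorphic_to_subgraph (with_proj K) (with_proj G)"
proof -
  interpret K: pair_wf_digraph K by fact
  interpret G: pair_wf_digraph G by fact
  let ?f = "\<lparr> iso_verts = f, iso_arcs = map_prod f f, iso_head = snd, iso_tail = fst \<rparr>"
  let ?H = "app_iso ?f (with_proj K)"
  have "inj_on (map_prod f f) (pverts K \<times> pverts K)"
    by (intro map_prod_inj_on assms)
  then have "inj_on (map_prod f f) (parcs K)"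
    by (rule inj_on_subset) (auto dest: K.in_arcsD1 K.in_arcsD2)
  then have iso: "K.digraph_isomorphism ?f"
    unfolding K.digraph_isomorphism_def
    using assms(3) K.wf_digraph_axioms by simp
  then have "wf_digraph ?H"
    by (rule K.wf_digraphI_app_iso)
  then have "subgraph ?H (with_proj G)"
    unfolding subgraph_def compatible_def
    using assms(4) arcs G.wf_digraph_axioms by auto
  with iso show ?thesis
    unfolding isomorphic_to_subgraph_def digraph_iso_def by blast
qed

text \<open>Injectivity is required only within a part: points of different parts lie at distance
  \<open>d > 0\<close>, hence differ.\<close>

lemma complete_multipartite_in_distance_graphI:
  fixes f :: "nat \<Rightarrow> nat \<Rightarrow> real ^ 'n"
  assumes "d > 0"
    and coord: "\<And>i j k. i < length ks \<Longrightarrow> j < ks ! i \<Longrightarrow> f i j $ k \<in> S"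
    and inj: "\<And>i. i < length ks \<Longrightarrow> inj_on (f i) {..<ks ! i}"
    and dist: "\<And>i j i' j'. \<lbrakk>i < i'; i' < length ks; j < ks ! i; j' < ks ! i'\<rbrakk>
                 \<Longrightarrow> dist (f i j) (f i' j') = d"
  shows "isomorphic_to_subgraph (with_proj (complete_multipartite ks))
           (with_proj (distance_graph S d :: (real ^ 'n) pair_pre_digraph))"
proof (rule isomorphic_to_subgraph_with_projI[where f = "case_prod f"])
  interpret pair_graph "complete_multipartite ks"
    by (rule pair_graph_complete_multipartite)
  show "pair_wf_digraph (complete_multipartite ks)"
    by unfold_locales
  interpret G: pair_bidirected_digraph "distance_graph S d :: (real ^ 'n) pair_pre_digraph"
    by (rule pair_bidirected_digraph_distance_graph) fact
  show "pair_wf_digraph (distance_graph S d :: (real ^ 'n) pair_pre_digraph)"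
    by unfold_locales
  have dist': "dist (f i j) (f i' j') = d"
    if "i \<noteq> i'" "i < length ks" "i' < length ks" "j < ks ! i" "j' < ks ! i'" for i i' j j'
    using that dist[of i i' j j'] dist[of i' i j' j] by (cases "i < i'") (auto simp: dist_commute)
  show "inj_on (case_prod f) (pverts (complete_multipartite ks))"
  proof (rule inj_onI, clarify)
    fix i j i' j'
    assume "(i, j) \<in> pverts (complete_multipartite ks)" "(i', j') \<in> pverts (complete_multipartite ks)"
      and eq: "f i j = f i' j'"
    then have *: "i < length ks" "i' < length ks" "j < ks ! i" "j' < ks ! i'"
      by (auto simp: complete_multipartite_def)
    then have "i = i'"
      using dist'[of i i' j j'] eq \<open>d > 0\<close> by auto
    with * eq show "i = i' \<and> j = j'"
      using inj[of i] by (auto dest: inj_onD)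
  qed
  show "case_prod f ` pverts (complete_multipartite ks) \<subseteq> pverts (distance_graph S d)"
    using coord by (auto simp: complete_multipartite_def distance_graph_def)
  show "(case_prod f u, case_prod f v) \<in> parcs (distance_graph S d)"
    if "(u, v) \<in> parcs (complete_multipartite ks)" for u v
    using that coord dist' by (auto simp: complete_multipartite_def distance_graph_def)
qed

section \<open>The configuration in dimension five\<close>

lemma exhaust_5:
  fixes x :: 5
  shows "x = 1 \<or> x = 2 \<or> x = 3 \<or> x = 4 \<or> x = 5"
proof (induct x)
  case (of_int z)
  then have "z = 0 \<or> z = 1 \<or> z = 2 \<or> z = 3 \<or> z = 4" by fastforce
  then show ?case by auto
qed

lemma UNIV_5: "UNIV = {1, 2, 3, 4, 5::5}"
  using exhaust_5 by auto

lemma sum_5: "sum f (UNIV::5 set) = f 1 + f 2 + f 3 + f 4 + f 5"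
  unfolding UNIV_5 by (simp add: ac_simps)

lemma vector_5 [simp]:
  "(vector [x, y, z, t, u] :: 'a::zero ^ 5) $ 1 = x"
  "(vector [x, y, z, t, u] :: 'a::zero ^ 5) $ 2 = y"
  "(vector [x, y, z, t, u] :: 'a::zero ^ 5) $ 3 = z"
  "(vector [x, y, z, t, u] :: 'a::zero ^ 5) $ 4 = t"
  "(vector [x, y, z, t, u] :: 'a::zero ^ 5) $ 5 = u"
  unfolding vector_def by simp_all

lemma dist_eq_sqrt_inner:
  fixes x y :: "'a::real_inner"
  shows "dist x y = sqrt (x \<bullet> x + y \<bullet> y - 2 * (x \<bullet> y))"
  by (simp add: dist_norm norm_eq_sqrt_inner inner_diff inner_commute)

theorem theorem3p9:
  fixes r :: rat
  assumes "r > 0"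
  shows "isomorphic_to_subgraph
           (with_proj (complete_multipartite [1, 3, 3]))
           (with_proj (distance_graph \<rat> (sqrt (of_rat r)) :: (real ^ 5) pair_pre_digraph))"
proof -
  have "sum_of_four_squares (r / 2)"
    using assms by (intro sum_of_four_squares_rat) simp
  then obtain a' b' c' d' where r: "r / 2 = a'\<^sup>2 + b'\<^sup>2 + c'\<^sup>2 + d'\<^sup>2"
    unfolding sum_of_four_squares_def by blast
  define a b c d :: real
    where abcd: "a = of_rat a'" "b = of_rat b'" "c = of_rat c'" "d = of_rat d'"
  define m :: real where "m = of_rat (r / 2)"
  have m: "a * a + b * b + c * c + d * d = m"
    unfolding m_def r abcd by (simp add: of_rat_add of_rat_power power2_eq_square of_rat_mult)
  have r_eq: "of_rat r = 2 * m"
    by (simp add: m_def of_rat_divide)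
  have "m > 0"
    using assms by (simp add: m_def)
  have Rats: "a \<in> \<rat>" "b \<in> \<rat>" "c \<in> \<rat>" "d \<in> \<rat>" "m \<in> \<rat>"
    by (simp_all add: abcd m_def)
  \<comment> \<open>With \<open>q = a + bi + cj + dk\<close>, the first four vectors are
    \<open>q\<close>, \<open>iq\<close>, \<open>jq\<close>, \<open>kq\<close>, padded by a
    zero.\<close>
  define v1 v2 v3 v4 e :: "real ^ 5"
    where v1_def: "v1 = vector [a, b, c, d, 0]"
      and v2_def: "v2 = vector [- b, a, - d, c, 0]"
      and v3_def: "v3 = vector [- c, d, a, - b, 0]"
      and v4_def: "v4 = vector [- d, - c, b, a, 0]"
      and e_def: "e = vector [0, 0, 0, 0, 1]"
  note v_defs = v1_def v2_def v3_def v4_def e_def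
  have gram:
    "v1 \<bullet> v1 = m" "v2 \<bullet> v2 = m" "v3 \<bullet> v3 = m" "v4 \<bullet> v4 = m" "e \<bullet> e = 1"
    "v1 \<bullet> v2 = 0" "v1 \<bullet> v3 = 0" "v1 \<bullet> v4 = 0" "v1 \<bullet> e = 0" "v2 \<bullet> v3 = 0"
    "v2 \<bullet> v4 = 0" "v2 \<bullet> e = 0" "v3 \<bullet> v4 = 0" "v3 \<bullet> e = 0" "v4 \<bullet> e = 0"
    unfolding m[symmetric] v_defs inner_vec_def sum_5 by (simp_all add: algebra_simps)
  \<comment> \<open>The ten vanishing products are added with their factors swapped.\<close>
  note gram' = gram gram(6-15)[THEN trans[OF inner_commute]]
  \<comment> \<open>Substituting \<open>y = x + 1\<close> into \<open>m x^2 + y^2 = m\<close> and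
    cancelling the root \<open>x = -1\<close> leaves \<open>x = s\<close>,
    \<open>y = t\<close>.\<close>
  define s t where "s = (m - 1) / (m + 1)" and "t = 2 * m / (m + 1)"
  have conic: "s * (s * m) + t * t = m"
    using \<open>m > 0\<close> unfolding s_def t_def by (simp add: divide_simps) algebra
  have "t \<noteq> 0"
    using \<open>m > 0\<close> by (simp add: t_def)
  have Rats': "s \<in> \<rat>" "t \<in> \<rat>"
    using Rats by (simp_all add: s_def t_def)
  define f :: "nat \<Rightarrow> nat \<Rightarrow> real ^ 5" where
    "f i j = [[0], [v1 + v2, v1 - v2, v1 + v3], [v1 + v4, v1 - v4, v1 + (s *\<^sub>R v4 + t *\<^sub>R e)]] ! i ! j"
    for i j
  have v_Rats: "v1 $ k \<in> \<rat>" "v2 $ k \<in> \<rat>" "v3 $ k \<in> \<rat>" "v4 $ k \<in> \<rat>" "e $ k \<in> \<rat>" for k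
    using exhaust_5[of k] Rats by (auto simp: v_defs)
  have distinct: "v2 \<noteq> - v2" "v2 \<noteq> v3" "- v2 \<noteq> v3"
    "v4 \<noteq> - v4" "v4 \<noteq> s *\<^sub>R v4 + t *\<^sub>R e" "- v4 \<noteq> s *\<^sub>R v4 + t *\<^sub>R e"
  proof -
    \<comment> \<open>Vectors are told apart by their inner product with \<open>v2\<close>,
      \<open>v4\<close> or \<open>e\<close>; the values differ because \<open>m\<close> and
      \<open>t\<close> are nonzero.\<close>
    have "v2 \<bullet> v2 \<noteq> - v2 \<bullet> v2" "v2 \<bullet> v2 \<noteq> v3 \<bullet> v2" "- v2 \<bullet> v2 \<noteq> v3 \<bullet> v2" "v4 \<bullet> v4 \<noteq> - v4 \<bullet> v4"
      "v4 \<bullet> e \<noteq> (s *\<^sub>R v4 + t *\<^sub>R e) \<bullet> e" "- v4 \<bullet> e \<noteq> (s *\<^sub>R v4 + t *\<^sub>R e) \<bullet> e"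
      using \<open>m > 0\<close> \<open>t \<noteq> 0\<close> by (simp_all add: inner_simps gram')
    then show "v2 \<noteq> - v2" "v2 \<noteq> v3" "- v2 \<noteq> v3" "v4 \<noteq> - v4"
      "v4 \<noteq> s *\<^sub>R v4 + t *\<^sub>R e" "- v4 \<noteq> s *\<^sub>R v4 + t *\<^sub>R e"
      by metis+
  qed
  show ?thesis
  proof (rule complete_multipartite_in_distance_graphI[where f = f])
    show "sqrt (of_rat r) > 0"
      using assms by simp
  next
    fix i j :: nat and k
    assume "i < length [1, 3, 3 :: nat]" "j < [1, 3, 3] ! i"
    then show "f i j $ k \<in> \<rat>"
      using v_Rats Rats' by (auto simp: f_def less_Suc_eq numeral_3_eq_3)
  next
    fix i
    assume "i < length [1, 3, 3 :: nat]"
    then show "inj_on (f i) {..<[1, 3, 3] ! i}"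
      using distinct by (auto simp: f_def less_Suc_eq numeral_3_eq_3 inj_on_def)
  next
    fix i j i' j' :: nat
    assume "i < i'" "i' < length [1, 3, 3 :: nat]" "j < [1, 3, 3] ! i" "j' < [1, 3, 3] ! i'"
    \<comment> \<open>Points \<open>v1 + u\<close> and \<open>v1 + w\<close> have squared length
      \<open>2 * m\<close> and inner product \<open>v1 \<bullet> v1 = m\<close>;
      \<open>conic\<close> supplies the length of the last \<open>w\<close>.\<close>
    then have "f i j \<bullet> f i j + f i' j' \<bullet> f i' j' - 2 * (f i j \<bullet> f i' j') = 2 * m"
      using conic by (auto simp: f_def less_Suc_eq numeral_3_eq_3 inner_simps gram')
    then show "dist (f i j) (f i' j') = sqrt (of_rat r)"
      by (simp add: dist_eq_sqrt_inner r_eq)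
  qed
qed

end
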